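(* Let $p$ be an odd prime, $n$ a positive integer and $q=p^n$. Then the subalgebra commutativity degree of the special linear Lie algebra $\mathfrak{sl}_2(\mathbb{F}_q)$ (as a Lie algebra over $\mathbb{F}_q$) is $$\mathrm{sd}(\mathfrak{sl}_2(\mathbb{F}_q))=\frac{3q^3+12q^2+16q+16}{(q^2+2q+4)^2}.$$
   Context: $\mathfrak{sl}_2(\mathbb{F}_q)$ is the Lie algebra over $\mathbb{F}_q$ of $2\times 2$ matrices of trace zero with entries in $\mathbb{F}_q$, with bracket $[a,b]=ab-ba$. For a finite dimensional Lie algebra $L$ over a finite field, $\mathcal{L}(L)$ denotes the (finite) set of all Lie subalgebras of $L$, including $\{0\}$ and $L$. For $A,B\in\mathcal{L}(L)$, $A+B$ is the vector space sum and $[A,B]$ is the smallest Lie subalgebra of $L$ containing all brackets $[a,b]$ with $a\in A$, $b\in B$. The subalgebra commutativity degree of $L$ is $$\mathrm{sd}(L)=\frac{1}{|\mathcal{L}(L)|^2}\left|\{(A,B)\in\mathcal{L}(L)\times\mathcal{L}(L) \mid [A,B]\subseteq A+B\}\right|.$$ *)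

theory Defs
  imports "HOL-Analysis.Analysis" "HOL-Computational_Algebra.Primes"
begin

text \<open>The underlying space of a Lie algebra is a subspace \<open>L\<close> of an ambient vector space, so that
  algebras of matrices can be treated as sets of matrices.\<close>

locale lie_algebra = vector_space scale
  for scale :: "'f::field \<Rightarrow> 'v::ab_group_add \<Rightarrow> 'v" +
  fixes bracket :: "'v \<Rightarrow> 'v \<Rightarrow> 'v" and L :: "'v set"
  assumes subspace_carrier: "subspace L"
    and bracket_closed: "x \<in> L \<Longrightarrow> y \<in> L \<Longrightarrow> bracket x y \<in> L"
    and bracket_add_left:
      "x \<in> L \<Longrightarrow> y \<in> L \<Longrightarrow> z \<in> L \<Longrightarrow> bracket (x + y) z = bracket x z + bracket y z"
    and bracket_add_right:
      "x \<in> L \<Longrightarrow> y \<in> L \<Longrightarrow> z \<in> L \<Longrightarrow> bracket x (y + z) = bracket x y + bracket x z"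
    and bracket_scale_left:
      "x \<in> L \<Longrightarrow> y \<in> L \<Longrightarrow> bracket (scale c x) y = scale c (bracket x y)"
    and bracket_scale_right:
      "x \<in> L \<Longrightarrow> y \<in> L \<Longrightarrow> bracket x (scale c y) = scale c (bracket x y)"
    and bracket_self: "x \<in> L \<Longrightarrow> bracket x x = 0"
    and jacobi: "x \<in> L \<Longrightarrow> y \<in> L \<Longrightarrow> z \<in> L \<Longrightarrow>
      bracket x (bracket y z) + bracket y (bracket z x) + bracket z (bracket x y) = 0"
begin

definition lie_subalgebra :: "'v set \<Rightarrow> bool" where
  "lie_subalgebra A \<longleftrightarrow> A \<subseteq> L \<and> subspace A \<and> (\<forall>a\<in>A. \<forall>b\<in>A. bracket a b \<in> A)"

definition subalgebras :: "'v set set" where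
  "subalgebras = {A. lie_subalgebra A}"

definition subalgebra_bracket :: "'v set \<Rightarrow> 'v set \<Rightarrow> 'v set" where
  "subalgebra_bracket A B = lie_subalgebra hull {bracket a b | a b. a \<in> A \<and> b \<in> B}"

definition subalgebra_sum :: "'v set \<Rightarrow> 'v set \<Rightarrow> 'v set" where
  "subalgebra_sum A B = {a + b | a b. a \<in> A \<and> b \<in> B}"

definition sd :: real where
  "sd = real (card {(A, B) \<in> subalgebras \<times> subalgebras.
                      subalgebra_bracket A B \<subseteq> subalgebra_sum A B})
        / (real (card subalgebras))\<^sup>2"

end

definition matrix_scale :: "'a::times \<Rightarrow> 'a^'n^'m \<Rightarrow> 'a^'n^'m" where
  "matrix_scale c = map_matrix ((*) c)"

definition commutator :: "'a::ring_1^'n^'n \<Rightarrow> 'a^'n^'n \<Rightarrow> 'a^'n^'n" where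
  "commutator a b = a ** b - b ** a"

definition sl2 :: "('a::field^2^2) set" where
  "sl2 = {a. trace a = 0}"

lemma matrix_scale_nth [simp]: "matrix_scale c a $ i $ j = c * a $ i $ j"
  by (simp add: matrix_scale_def map_matrix_def)

lemma vector_space_matrix_scale:
  "vector_space (matrix_scale :: 'a::field \<Rightarrow> 'a^'n^'m \<Rightarrow> 'a^'n^'m)"
  by unfold_locales (simp_all add: vec_eq_iff algebra_simps)

interpretation sl2: lie_algebra matrix_scale commutator sl2
proof -
  interpret vector_space "matrix_scale :: 'a \<Rightarrow> 'a^2^2 \<Rightarrow> 'a^2^2"
    by (rule vector_space_matrix_scale)
  show "lie_algebra (matrix_scale :: 'a \<Rightarrow> 'a^2^2 \<Rightarrow> 'a^2^2) commutator sl2"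
  proof unfold_locales
    show "subspace (sl2 :: ('a^2^2) set)"
    proof (rule subspaceI)
      fix c :: 'a and x :: "'a^2^2"
      have "trace (matrix_scale c x) = c * trace x"
        by (simp add: trace_def sum_distrib_left)
      then show "x \<in> sl2 \<Longrightarrow> matrix_scale c x \<in> sl2"
        by (simp add: sl2_def)
    qed (simp_all add: sl2_def trace_add flip: mat_0, simp add: trace_def mat_def)
  qed (simp_all add: sl2_def trace_def commutator_def vec_eq_iff forall_2 sum_2
        matrix_matrix_mult_def algebra_simps)
qed

end

theory Submission
  imports Defs "HOL-Number_Theory.Residues"
begin

text \<open>In the coordinates \<open>(v\<^sub>1\<^sub>1, v\<^sub>1\<^sub>2, v\<^sub>2\<^sub>1)\<close> the bracket of \<open>v\<close> and \<open>w\<close> is \<open>(n\<^sub>1, 2 n\<^sub>3, 2 n\<^sub>2)\<close>, where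
  \<open>n\<close> is the cross product of the coordinate vectors. A plane with normal vector \<open>n\<close> is therefore a
  subalgebra iff \<open>n\<close> lies on the conic \<open>n\<^sub>1\<^sup>2 + 4 n\<^sub>2 n\<^sub>3 = 0\<close>, which has \<open>q + 1\<close> points; these planes are
  the Borel subalgebras. So there are \<open>1 + (q\<^sup>2 + q + 1) + (q + 1) + 1\<close> subalgebras. The sum of a Borel
  subalgebra and any subalgebra is a subalgebra, so a pair can fail to permute only if it consists of
  two distinct lines, and it does fail unless the two lines span a Borel subalgebra. Each Borel
  subalgebra contains \<open>q + 1\<close> lines, so exactly \<open>(q + 1)\<^sup>2 q\<close> ordered pairs of distinct lines permute.\<close>

section \<open>Coordinates\<close>

lemma mem_sl2_iff: "v \<in> sl2 \<longleftrightarrow> v $ 2 $ 2 = - v $ 1 $ 1"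
  by (auto simp: sl2_def trace_def sum_2 add_eq_0_iff)

lemma sl2_eqI:
  assumes "v \<in> sl2" "w \<in> sl2"
    and "v $ 1 $ 1 = w $ 1 $ 1" "v $ 1 $ 2 = w $ 1 $ 2" "v $ 2 $ 1 = w $ 2 $ 1"
  shows "v = w"
  using assms by (simp add: vec_eq_iff forall_2 mem_sl2_iff)

lemma commutator_nth:
  assumes "v \<in> sl2" "w \<in> sl2"
  shows "commutator v w $ 1 $ 1 = v $ 1 $ 2 * w $ 2 $ 1 - v $ 2 $ 1 * w $ 1 $ 2"
    and "commutator v w $ 1 $ 2 = 2 * (v $ 1 $ 1 * w $ 1 $ 2 - v $ 1 $ 2 * w $ 1 $ 1)"
    and "commutator v w $ 2 $ 1 = 2 * (v $ 2 $ 1 * w $ 1 $ 1 - v $ 1 $ 1 * w $ 2 $ 1)"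
  using assms
  by (simp_all add: commutator_def matrix_matrix_mult_def sum_2 mem_sl2_iff algebra_simps)

definition sl2_of :: "'a::field \<Rightarrow> 'a \<Rightarrow> 'a \<Rightarrow> 'a^2^2" where
  "sl2_of x y z = vector [vector [x, y], vector [z, - x]]"

lemma sl2_of_nth [simp]:
  "sl2_of x y z $ 1 $ 1 = x" "sl2_of x y z $ 1 $ 2 = y"
  "sl2_of x y z $ 2 $ 1 = z" "sl2_of x y z $ 2 $ 2 = - x"
  by (simp_all add: sl2_of_def)

lemma sl2_of_mem [simp]: "sl2_of x y z \<in> sl2"
  by (simp add: mem_sl2_iff)

lemma card_sl2: "card (sl2 :: ('a::{field,finite}^2^2) set) = CARD('a) ^ 3"
proof -
  have "bij_betw (\<lambda>(x, y, z). sl2_of x y z) UNIV (sl2 :: ('a^2^2) set)"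
    by (rule bij_betw_byWitness[where f' = "\<lambda>v. (v $ 1 $ 1, v $ 1 $ 2, v $ 2 $ 1)"])
      (auto intro: sl2_eqI)
  then have "card (sl2 :: ('a^2^2) set) = CARD('a \<times> 'a \<times> 'a)"
    using bij_betw_same_card by metis
  then show ?thesis
    by (simp add: card_cartesian_product power3_eq_cube flip: UNIV_Times_UNIV)
qed

section \<open>Finite fields of odd order\<close>

lemma card_field_gt_1: "CARD('a::{field,finite}) > 1"
  using card_mono[of UNIV "{0, 1 :: 'a}"] by simp

text \<open>The four kinds of subalgebras have 1, \<open>q\<close>, \<open>q^2\<close> and
  \<open>q^3\<close> elements; these inequalities let cardinality tell them apart.\<close>

lemma card_field_powers_distinct:
  "1 \<noteq> CARD('a::{field,finite})" "1 \<noteq> (CARD('a))\<^sup>2" "1 \<noteq> CARD('a) ^ 3"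
  "CARD('a) \<noteq> (CARD('a))\<^sup>2" "CARD('a) \<noteq> CARD('a) ^ 3" "(CARD('a))\<^sup>2 \<noteq> CARD('a) ^ 3"
  using card_field_gt_1[where 'a = 'a] power_inject_exp[of "CARD('a)" 0]
    power_inject_exp[of "CARD('a)" 1] power_inject_exp[of "CARD('a)" 2 3] by simp_all

text \<open>If 2 vanished, the characteristic would be 2, and it divides the order of the field.
  This is where the oddness of \<open>p\<close> enters.\<close>

lemma two_neq_zero_if_odd_card:
  assumes "odd CARD('a::{field,finite})"
  shows "(2 :: 'a) \<noteq> 0"
proof
  assume "(2 :: 'a) = 0"
  then have "of_nat 2 = (0 :: 'a)"
    by simp
  then have "CHAR('a) dvd 2"
    by (simp only: of_nat_eq_0_iff_char_dvd)
  moreover have "CHAR('a) \<noteq> 1"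
    by (metis of_nat_CHAR of_nat_1 zero_neq_one)
  ultimately have "CHAR('a) = 2"
    using two_is_prime_nat by (metis prime_nat_iff)
  with CHAR_dvd_CARD[where 'a = 'a] assms show False
    by simp
qed

section \<open>Lines\<close>

definition line :: "'a::field^2^2 \<Rightarrow> ('a^2^2) set" where
  "line a = range (\<lambda>c. matrix_scale c a)"

definition lines :: "('a::field^2^2) set set" where
  "lines = line ` (sl2 - {0})"

text \<open>Any nonzero vector of a line generates it, because its coefficient can be inverted.
  Hence distinct lines meet only in 0.\<close>

lemma line_eq_of_mem:
  assumes "A \<in> lines" "x \<in> A" "x \<noteq> 0"
  shows "A = line x"
proof -
  obtain a c where A: "A = line a" and x: "x = matrix_scale c a"
    using assms by (auto simp: lines_def line_def)
  have "c \<noteq> 0"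
    using x \<open>x \<noteq> 0\<close> by auto
  then have "matrix_scale d a = matrix_scale (d / c) x"
    and "matrix_scale d x = matrix_scale (d * c) a" for d
    by (simp_all add: x)
  then show ?thesis
    unfolding A line_def by (metis (no_types, lifting) image_subset_iff rangeI subset_antisym)
qed

lemma line_subset_subspace:
  "sl2.subspace W \<Longrightarrow> a \<in> W \<Longrightarrow> line a \<subseteq> W"
  by (auto simp: line_def sl2.subspace_scale)

lemma mem_line_self: "a \<in> line a"
  by (auto simp: line_def intro!: range_eqI[of _ _ 1])

lemma line_in_lines: "a \<in> sl2 \<Longrightarrow> a \<noteq> 0 \<Longrightarrow> line a \<in> lines"
  by (auto simp: lines_def)

lemma lines_obtain:
  assumes "A \<in> lines"
  obtains a where "a \<in> sl2" "a \<noteq> 0" "a \<in> A" "A = line a"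
  using assms mem_line_self by (auto simp: lines_def)

lemma card_line:
  assumes "A \<in> lines"
  shows "card (A :: ('a::{field,finite}^2^2) set) = CARD('a)"
proof -
  obtain a where a: "a \<noteq> 0" "A = line a"
    using assms by (auto simp: lines_def)
  then have "inj (\<lambda>c. matrix_scale c a)"
    by (auto simp: inj_def)
  then show ?thesis
    by (simp add: a line_def card_image)
qed

lemma lie_subalgebra_line:
  assumes "A \<in> lines"
  shows "sl2.lie_subalgebra A"
proof -
  obtain a where a: "a \<in> sl2" "A = line a"
    using assms by (auto simp: lines_def)
  have sub: "sl2.subspace A"
    unfolding a(2) line_def sl2.subspace_def
    by (auto simp flip: sl2.scale_left_distrib intro: range_eqI[of _ _ 0])
  have "commutator x y = 0" if "x \<in> A" "y \<in> A" for x y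
    using that a
    by (auto simp: line_def sl2.bracket_scale_left sl2.bracket_scale_right sl2.bracket_self
        sl2.subspace_scale[OF sl2.subspace_carrier])
  then show ?thesis
    unfolding sl2.lie_subalgebra_def
    using sub a line_subset_subspace[OF sl2.subspace_carrier] sl2.subspace_0[OF sub] by auto
qed

text \<open>Removing 0 from the lines in \<open>W\<close> leaves blocks of size \<open>q - 1\<close>
  that partition \<open>W - {0}\<close>. The lemma is applied to \<open>sl2\<close> and to the Borel
  subalgebras.\<close>

lemma card_lines_in_subspace:
  fixes W :: "('a::{field,finite}^2^2) set"
  assumes "sl2.subspace W" "W \<subseteq> sl2"
  shows "(CARD('a) - 1) * card {A \<in> lines. A \<subseteq> W} = card W - 1"
proof -
  let ?X = "{A \<in> lines. A \<subseteq> W}"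
  have zero: "0 \<in> A" if "A \<in> lines" for A :: "('a^2^2) set"
    using lie_subalgebra_line[OF that] by (simp add: sl2.lie_subalgebra_def sl2.subspace_0)
  have "(CARD('a) - 1) * card ((\<lambda>A. A - {0}) ` ?X) = card (\<Union>((\<lambda>A. A - {0}) ` ?X))"
  proof (rule card_partition)
    show "card c = CARD('a) - 1" if "c \<in> (\<lambda>A. A - {0}) ` ?X" for c
      using that zero by (auto simp: card_line)
    show "c1 \<inter> c2 = {}"
      if "c1 \<in> (\<lambda>A. A - {0}) ` ?X" "c2 \<in> (\<lambda>A. A - {0}) ` ?X" "c1 \<noteq> c2" for c1 c2
    proof (rule ccontr)
      assume "c1 \<inter> c2 \<noteq> {}"
      then obtain x where "x \<in> c1" "x \<in> c2"
        by auto
      with that line_eq_of_mem show False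
        by blast
    qed
  qed auto
  moreover have "\<Union>((\<lambda>A. A - {0}) ` ?X) = W - {0}"
  proof (intro equalityI subsetI)
    fix x assume "x \<in> W - {0}"
    then have "line x \<in> ?X" "x \<in> line x - {0}"
      using line_in_lines[OF subsetD[OF assms(2)]] mem_line_self
        line_subset_subspace[OF assms(1)] by auto
    then show "x \<in> \<Union>((\<lambda>A. A - {0}) ` ?X)"
      by blast
  qed auto
  moreover have "inj_on (\<lambda>A. A - {0}) ?X"
    using zero by (auto simp: inj_on_def)
  ultimately show ?thesis
    using sl2.subspace_0[OF assms(1)] by (simp add: card_image)
qed

lemma card_lines: "card (lines :: ('a::{field,finite}^2^2) set set) = CARD('a)\<^sup>2 + CARD('a) + 1"
proof -
  have "{A \<in> lines. A \<subseteq> (sl2 :: ('a^2^2) set)} = lines"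
    using lie_subalgebra_line by (auto simp: sl2.lie_subalgebra_def)
  then have "(CARD('a) - 1) * card (lines :: ('a^2^2) set set) = CARD('a) ^ 3 - 1"
    using card_lines_in_subspace[OF sl2.subspace_carrier subset_refl, where 'a = 'a]
    by (simp add: card_sl2)
  also have "\<dots> = (CARD('a) - 1) * (CARD('a)\<^sup>2 + CARD('a) + 1)"
    by (simp add: power2_eq_square power3_eq_cube algebra_simps)
  finally show ?thesis
    using card_field_gt_1[where 'a = 'a] by (simp only: mult_cancel1) simp
qed

section \<open>Planes\<close>

definition plane :: "'a::field \<Rightarrow> 'a \<Rightarrow> 'a \<Rightarrow> ('a^2^2) set" where
  "plane \<alpha> \<beta> \<gamma> = {v \<in> sl2. \<alpha> * v $ 1 $ 1 + \<beta> * v $ 1 $ 2 + \<gamma> * v $ 2 $ 1 = 0}"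

text \<open>The normal vectors run through the points \<open>(2 t, 1, - t\<^sup>2)\<close> and \<open>(0, 0, 1)\<close> of the conic
  \<open>n\<^sub>1\<^sup>2 + 4 n\<^sub>2 n\<^sub>3 = 0\<close>.\<close>

definition borels :: "('a::field^2^2) set set" where
  "borels = insert (plane 0 0 1) (range (\<lambda>t. plane (2 * t) 1 (- t\<^sup>2)))"

lemma subspace_plane: "sl2.subspace (plane \<alpha> \<beta> (\<gamma> :: 'a::field))"
  unfolding sl2.subspace_def plane_def
proof (intro conjI ballI allI; (elim CollectE conjE)?; intro CollectI conjI)
  fix c and v :: "'a^2^2" assume "v \<in> sl2" "\<alpha> * v $ 1 $ 1 + \<beta> * v $ 1 $ 2 + \<gamma> * v $ 2 $ 1 = 0"
  moreover have "\<alpha> * (c * v $ 1 $ 1) + \<beta> * (c * v $ 1 $ 2) + \<gamma> * (c * v $ 2 $ 1) =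
      c * (\<alpha> * v $ 1 $ 1 + \<beta> * v $ 1 $ 2 + \<gamma> * v $ 2 $ 1)"
    by (simp add: algebra_simps)
  ultimately show "\<alpha> * matrix_scale c v $ 1 $ 1 + \<beta> * matrix_scale c v $ 1 $ 2
      + \<gamma> * matrix_scale c v $ 2 $ 1 = 0"
    by simp
next
  fix v w :: "'a^2^2" assume "\<alpha> * v $ 1 $ 1 + \<beta> * v $ 1 $ 2 + \<gamma> * v $ 2 $ 1 = 0"
    "\<alpha> * w $ 1 $ 1 + \<beta> * w $ 1 $ 2 + \<gamma> * w $ 2 $ 1 = 0"
  moreover have "\<alpha> * (v + w) $ 1 $ 1 + \<beta> * (v + w) $ 1 $ 2 + \<gamma> * (v + w) $ 2 $ 1 =
      (\<alpha> * v $ 1 $ 1 + \<beta> * v $ 1 $ 2 + \<gamma> * v $ 2 $ 1) +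
      (\<alpha> * w $ 1 $ 1 + \<beta> * w $ 1 $ 2 + \<gamma> * w $ 2 $ 1)"
    by (simp add: algebra_simps)
  ultimately show "\<alpha> * (v + w) $ 1 $ 1 + \<beta> * (v + w) $ 1 $ 2 + \<gamma> * (v + w) $ 2 $ 1 = 0"
    by simp
qed (auto simp: sl2.subspace_0[OF sl2.subspace_carrier] sl2.subspace_add[OF sl2.subspace_carrier]
      sl2.subspace_scale[OF sl2.subspace_carrier])

lemma borels_cases:
  assumes "C \<in> borels"
  obtains \<alpha> \<beta> \<gamma> where "C = plane \<alpha> \<beta> \<gamma>"
  using assms by (auto simp: borels_def)

lemma borel_subset_sl2: "C \<in> borels \<Longrightarrow> C \<subseteq> sl2"
  by (auto simp: borels_def plane_def)

text \<open>Each of these planes consists of the trace-zero matrices with a prescribed eigenvector: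
  the column (1, 0) for \<open>plane 0 0 1\<close>, which is the upper triangular case, and the
  column (t, 1) for parameter \<open>t\<close>. Closure is checked by computation in
  coordinates.\<close>

lemma lie_subalgebra_borel:
  assumes "C \<in> borels"
  shows "sl2.lie_subalgebra C"
proof -
  have "commutator v w \<in> C" if "v \<in> C" "w \<in> C" for v w
  proof (cases "C = plane 0 0 1")
    case True
    with that show ?thesis
      by (auto simp: plane_def commutator_nth sl2.bracket_closed)
  next
    case False
    then obtain t where C: "C = plane (2 * t) 1 (- t\<^sup>2)"
      using assms by (auto simp: borels_def)
    \<comment> \<open>The second entry of the normal is 1, so the plane equation can be solved for
      the upper right entry. After substitution, the equation for the commutator is a polynomial
      identity.\<close>
    have "v $ 1 $ 2 = t\<^sup>2 * v $ 2 $ 1 - 2 * t * v $ 1 $ 1"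
      "w $ 1 $ 2 = t\<^sup>2 * w $ 2 $ 1 - 2 * t * w $ 1 $ 1"
      using that by (auto simp: C plane_def algebra_simps eq_neg_iff_add_eq_0)
    then show ?thesis
      using that unfolding C plane_def
      by (simp add: commutator_nth sl2.bracket_closed, simp add: algebra_simps power2_eq_square)
  qed
  moreover have "sl2.subspace C"
    using assms borels_cases subspace_plane by metis
  ultimately show ?thesis
    using borel_subset_sl2[OF assms] by (simp add: sl2.lie_subalgebra_def)
qed

lemma card_borel:
  assumes "C \<in> borels"
  shows "card (C :: ('a::{field,finite}^2^2) set) = (CARD('a))\<^sup>2"
proof -
  have "\<exists>f. bij_betw f (UNIV :: ('a \<times> 'a) set) C"
  proof (cases "C = plane 0 0 1")
    case True
    have "bij_betw (\<lambda>(x, y). sl2_of x y 0) UNIV C"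
      by (rule bij_betw_byWitness[where f' = "\<lambda>v. (v $ 1 $ 1, v $ 1 $ 2)"])
        (auto intro: sl2_eqI simp: True plane_def)
    then show ?thesis by blast
  next
    case False
    then obtain t where C: "C = plane (2 * t) 1 (- t\<^sup>2)"
      using assms by (auto simp: borels_def)
    have "bij_betw (\<lambda>(x, z). sl2_of x (t\<^sup>2 * z - 2 * t * x) z) UNIV C"
      by (rule bij_betw_byWitness[where f' = "\<lambda>v. (v $ 1 $ 1, v $ 2 $ 1)"])
        (auto intro!: sl2_eqI simp: C plane_def algebra_simps eq_neg_iff_add_eq_0)
    then show ?thesis by blast
  qed
  then have "card C = CARD('a \<times> 'a)"
    using bij_betw_same_card by metis
  then show ?thesis
    by (simp add: card_cartesian_product power2_eq_square flip: UNIV_Times_UNIV)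
qed

lemma card_borels:
  assumes "(2 :: 'a::{field,finite}) \<noteq> 0"
  shows "card (borels :: ('a^2^2) set set) = CARD('a) + 1"
proof -
  let ?P = "\<lambda>t::'a. plane (2 * t) 1 (- t\<^sup>2)"
  have "inj ?P"
  proof (rule injI)
    fix s t :: 'a assume "?P s = ?P t"
    \<comment> \<open>For this matrix, membership in the plane of \<open>t\<close> reads
      \<open>2 * t = 2 * s\<close>, which determines the parameter since 2 is nonzero.\<close>
    moreover have "sl2_of 1 (- 2 * s) 0 \<in> ?P s"
      by (simp add: plane_def)
    ultimately have "sl2_of 1 (- 2 * s) 0 \<in> ?P t"
      by simp
    then have "2 * t = 2 * s"
      by (simp add: plane_def)
    with assms show "s = t"
      by simp
  qed
  moreover have "plane 0 0 1 \<notin> range ?P"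
  proof
    assume "plane 0 0 1 \<in> range ?P"
    then obtain t where "plane 0 0 1 = ?P t"
      by auto
    \<comment> \<open>This matrix is strictly upper triangular and violates the equation of every
      \<open>?P t\<close>, where its only nonzero coordinate has coefficient 1.\<close>
    moreover have "sl2_of 0 1 0 \<in> plane 0 0 (1 :: 'a)"
      by (simp add: plane_def)
    ultimately have "sl2_of 0 1 0 \<in> ?P t"
      by simp
    then show False
      by (simp add: plane_def)
  qed
  ultimately show ?thesis
    by (simp add: borels_def card_image)
qed

section \<open>Classification of subalgebras\<close>

text \<open>The determinant of the three coordinate vectors, expanded along \<open>c\<close>: the
  coefficients form the cross product of \<open>a\<close> and \<open>b\<close>.\<close>

definition det3 :: "'a::field^2^2 \<Rightarrow> 'a^2^2 \<Rightarrow> 'a^2^2 \<Rightarrow> 'a" where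
  "det3 a b c =
    (a $ 1 $ 2 * b $ 2 $ 1 - a $ 2 $ 1 * b $ 1 $ 2) * c $ 1 $ 1 +
    (a $ 2 $ 1 * b $ 1 $ 1 - a $ 1 $ 1 * b $ 2 $ 1) * c $ 1 $ 2 +
    (a $ 1 $ 1 * b $ 1 $ 2 - a $ 1 $ 2 * b $ 1 $ 1) * c $ 2 $ 1"

text \<open>Cramer's rule without division, a polynomial identity in the coordinates.\<close>

lemma cramer_sl2:
  assumes "a \<in> sl2" "b \<in> sl2" "c \<in> sl2" "v \<in> sl2"
  shows "matrix_scale (det3 a b c) v =
    matrix_scale (det3 v b c) a + matrix_scale (det3 a v c) b + matrix_scale (det3 a b v) c"
proof (rule sl2_eqI)
  show "matrix_scale (det3 a b c) v \<in> sl2"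
    using assms by (intro sl2.subspace_scale[OF sl2.subspace_carrier])
  show "matrix_scale (det3 v b c) a + matrix_scale (det3 a v c) b + matrix_scale (det3 a b v) c
      \<in> sl2"
    using assms
    by (intro sl2.subspace_add[OF sl2.subspace_carrier] sl2.subspace_scale[OF sl2.subspace_carrier])
qed (simp_all add: det3_def algebra_simps)

text \<open>The last hypothesis puts the third term of Cramer's rule into \<open>A\<close> in two
  situations: \<open>c\<close> itself lies in \<open>A\<close>, which then is all of
  \<open>sl2\<close>, or \<open>v\<close> lies in the plane spanned by \<open>a\<close> and
  \<open>b\<close>, and \<open>c\<close> is only an auxiliary vector off that plane.\<close>

lemma in_subspace_by_cramer:
  assumes "sl2.subspace A" "A \<subseteq> sl2" "a \<in> A" "b \<in> A" "c \<in> sl2" "v \<in> sl2"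
    and "det3 a b c \<noteq> 0" and "c \<in> A \<or> det3 a b v = 0"
  shows "v \<in> A"
proof -
  have "matrix_scale (det3 a b v) c \<in> A"
    using assms(8) sl2.subspace_scale[OF assms(1)] sl2.subspace_0[OF assms(1)] by auto
  then have "matrix_scale (det3 a b c) v \<in> A"
    using assms
    by (subst cramer_sl2)
      (blast intro: sl2.subspace_add[OF assms(1)] sl2.subspace_scale[OF assms(1)])+
  then have "matrix_scale (inverse (det3 a b c)) (matrix_scale (det3 a b c) v) \<in> A"
    using assms(1) by (rule sl2.subspace_scale[rotated])
  then show ?thesis
    using assms(7) by simp
qed

text \<open>Beyond dimension one, \<open>A\<close> contains independent \<open>a\<close> and
  \<open>b\<close>, with cross product \<open>n\<close>. Either \<open>A\<close> leaves the plane
  normal to \<open>n\<close> and is everything, or it equals that plane; closure at the single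
  bracket of \<open>a\<close> and \<open>b\<close> then puts \<open>n\<close> on the conic.\<close>

lemma subalgebra_cases:
  fixes A :: "('a::field^2^2) set"
  assumes two: "(2 :: 'a) \<noteq> 0" and A: "sl2.lie_subalgebra A"
  shows "A = {0} \<or> A \<in> lines \<or> A \<in> borels \<or> A = sl2"
proof -
  have sub: "sl2.subspace A" and sl: "A \<subseteq> sl2"
    and br: "\<And>x y. x \<in> A \<Longrightarrow> y \<in> A \<Longrightarrow> commutator x y \<in> A"
    using A by (auto simp: sl2.lie_subalgebra_def)
  show ?thesis
  proof (cases "A = {0} \<or> A \<in> lines")
    case False
    then obtain a where a: "a \<in> A" "a \<noteq> 0"
      using sl2.subspace_0[OF sub] by auto
    have "line a \<in> lines"
      using a sl by (auto intro: line_in_lines)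
    with False have "A \<noteq> line a"
      by auto
    then obtain b where b: "b \<in> A" "b \<notin> line a"
      using line_subset_subspace[OF sub a(1)] by auto
    note slm = subsetD[OF sl a(1)] subsetD[OF sl b(1)]
    define n1 where "n1 = a $ 1 $ 2 * b $ 2 $ 1 - a $ 2 $ 1 * b $ 1 $ 2"
    define n2 where "n2 = a $ 2 $ 1 * b $ 1 $ 1 - a $ 1 $ 1 * b $ 2 $ 1"
    define n3 where "n3 = a $ 1 $ 1 * b $ 1 $ 2 - a $ 1 $ 2 * b $ 1 $ 1"
    have det: "det3 a b v = n1 * v $ 1 $ 1 + n2 * v $ 1 $ 2 + n3 * v $ 2 $ 1" for v
      by (simp add: det3_def n1_def n2_def n3_def)
    \<comment> \<open>If all three minors vanished, dividing by a nonzero coordinate of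
      \<open>a\<close> would exhibit \<open>b\<close> as a multiple of \<open>a\<close>.\<close>
    have n: "n1 \<noteq> 0 \<or> n2 \<noteq> 0 \<or> n3 \<noteq> 0"
    proof (rule ccontr)
      assume "\<not> ?thesis"
      then have eqs: "a $ 1 $ 2 * b $ 2 $ 1 = a $ 2 $ 1 * b $ 1 $ 2"
        "a $ 2 $ 1 * b $ 1 $ 1 = a $ 1 $ 1 * b $ 2 $ 1"
        "a $ 1 $ 1 * b $ 1 $ 2 = a $ 1 $ 2 * b $ 1 $ 1"
        by (auto simp: n1_def n2_def n3_def)
      have mem: "b \<in> line a" if "b = matrix_scale c a" for c
        using that by (auto simp: line_def)
      have sc: "matrix_scale c a \<in> sl2" for c
        using sl2.subspace_carrier slm(1) by (rule sl2.subspace_scale)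
      consider "a $ 1 $ 1 \<noteq> 0" | "a $ 1 $ 2 \<noteq> 0" | "a $ 2 $ 1 \<noteq> 0"
        using a slm sl2_eqI[of a 0] sl2.subspace_0[OF sl2.subspace_carrier] by fastforce
      then show False
      proof cases
        case 1
        have "b = matrix_scale (b $ 1 $ 1 / a $ 1 $ 1) a"
          using 1 eqs by (intro sl2_eqI slm sc) (auto simp: field_simps)
        with mem b show False by blast
      next
        case 2
        have "b = matrix_scale (b $ 1 $ 2 / a $ 1 $ 2) a"
          using 2 eqs by (intro sl2_eqI slm sc) (auto simp: field_simps)
        with mem b show False by blast
      next
        case 3
        have "b = matrix_scale (b $ 2 $ 1 / a $ 2 $ 1) a"
          using 3 eqs by (intro sl2_eqI slm sc) (auto simp: field_simps)
        with mem b show False by blast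
      qed
    qed
    show ?thesis
    proof (cases "\<exists>c\<in>A. det3 a b c \<noteq> 0")
      case True
      then have "sl2 \<subseteq> A"
        using in_subspace_by_cramer[OF sub sl a(1) b(1)] sl by blast
      with sl show ?thesis
        by auto
    next
      case False
      \<comment> \<open>Since \<open>n\<close> is nonzero, one of the three coordinate vectors lies
        off the plane and completes \<open>a\<close>, \<open>b\<close> to a basis.\<close>
      obtain c where c: "c \<in> sl2" "det3 a b c \<noteq> 0"
        using n sl2_of_mem[of 1 0 0] sl2_of_mem[of 0 1 0] sl2_of_mem[of 0 0 1]
        by (metis (no_types) det mult_zero_right mult.right_neutral add_0_left add_0_right
            sl2_of_nth(1-3))
      have plane: "A = plane n1 n2 n3"
        using False sl in_subspace_by_cramer[OF sub sl a(1) b(1) c(1) _ c(2)]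
        by (auto simp: plane_def simp flip: det)
      \<comment> \<open>The bracket has coordinates (n1, 2 n3, 2 n2), so pairing it with
        \<open>n\<close> yields the conic equation.\<close>
      have "det3 a b (commutator a b) = 0"
        using False br a b by blast
      then have conic: "n1 * n1 + 4 * n2 * n3 = 0"
        by (simp add: det commutator_nth[OF slm] flip: n1_def n2_def n3_def)
          (simp add: n2_def n3_def algebra_simps)
      have "A \<in> borels"
      proof (cases "n2 = 0")
        case True
        then have "n1 = 0" "n3 \<noteq> 0"
          using conic n by auto
        with True have "A = plane 0 0 1"
          by (simp add: plane plane_def)
        then show ?thesis
          by (simp add: borels_def)
      next
        case n2: False
        \<comment> \<open>Chosen so that \<open>n\<close> is \<open>n2\<close> times (2 t, 1, -
          t^2): the first coordinate dictates \<open>t\<close>, and the conic equation then gives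
          the third.\<close>
        define t where "t = n1 / (2 * n2)"
        have n1: "n1 = n2 * (2 * t)"
          using n2 two by (simp add: t_def)
        have "4 * n2 * (n3 + n2 * t\<^sup>2) = 0"
          using conic by (simp add: n1 power2_eq_square algebra_simps)
        moreover have "(4 :: 'a) \<noteq> 0"
          using two by (metis mult_2 numeral_Bit0 mult_eq_0_iff)
        ultimately have n3: "n3 = n2 * (- t\<^sup>2)"
          using n2 by (simp add: eq_neg_iff_add_eq_0)
        have "n1 * x + n2 * y + n3 * z = n2 * (2 * t * x + 1 * y + (- t\<^sup>2) * z)" for x y z
          by (simp add: n1 n3 algebra_simps)
        then have "A = plane (2 * t) 1 (- t\<^sup>2)"
          using n2 by (simp add: plane plane_def)
        then show ?thesis
          by (simp add: borels_def)
      qed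
      then show ?thesis
        by simp
    qed
  qed auto
qed

lemma subalgebras_sl2:
  assumes "(2 :: 'a::field) \<noteq> 0"
  shows "sl2.subalgebras = {{0}, sl2} \<union> lines \<union> (borels :: ('a^2^2) set set)"
proof -
  have "sl2.lie_subalgebra {0 :: 'a^2^2}"
    by (simp add: sl2.lie_subalgebra_def sl2.subspace_0[OF sl2.subspace_carrier]
        sl2.bracket_self)
  moreover have "sl2.lie_subalgebra (sl2 :: ('a^2^2) set)"
    by (simp add: sl2.lie_subalgebra_def sl2.subspace_carrier sl2.bracket_closed)
  ultimately show ?thesis
    using subalgebra_cases[OF assms] lie_subalgebra_line lie_subalgebra_borel
    by (auto simp: sl2.subalgebras_def)
qed

lemma card_subalgebras_sl2:
  assumes "(2 :: 'a::{field,finite}) \<noteq> 0"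
  shows "card (sl2.subalgebras :: ('a^2^2) set set) = (CARD('a))\<^sup>2 + 2 * CARD('a) + 4"
proof -
  note ne = card_field_powers_distinct[where 'a = 'a]
  have zero: "card {0 :: 'a^2^2} = 1"
    by simp
  have "{0} \<noteq> (sl2 :: ('a^2^2) set)"
    using ne zero card_sl2 by metis
  moreover have "{0} \<notin> (lines :: ('a^2^2) set set)" "{0} \<notin> (borels :: ('a^2^2) set set)"
    using ne zero card_line card_borel by metis+
  moreover have "(sl2 :: ('a^2^2) set) \<notin> lines" "(sl2 :: ('a^2^2) set) \<notin> borels"
    using ne card_line card_borel card_sl2 by metis+
  moreover have "A \<notin> borels" if "A \<in> lines" for A :: "('a^2^2) set"
    using ne that card_line card_borel by metis
  then have "lines \<inter> borels = ({} :: ('a^2^2) set set)"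
    by blast
  ultimately show ?thesis
    by (simp add: subalgebras_sl2[OF assms] card_Un_disjoint card_lines card_borels[OF assms])
qed

section \<open>Permuting pairs of subalgebras\<close>

context lie_algebra
begin

lemma subalgebra_sum_commute: "subalgebra_sum A B = subalgebra_sum B A"
  by (auto simp: subalgebra_sum_def intro: add.commute)

lemma subalgebra_sum_absorb:
  assumes "subspace A" "subspace B" "A \<subseteq> B"
  shows "subalgebra_sum A B = B"
proof
  show "subalgebra_sum A B \<subseteq> B"
    using assms by (auto simp: subalgebra_sum_def intro: subspace_add)
  show "B \<subseteq> subalgebra_sum A B"
    using subspace_0[OF assms(1)] by (force simp: subalgebra_sum_def)
qed

text \<open>A sum that is a subalgebra contains \<open>A\<close>, \<open>B\<close> and hence all
  their brackets, so it contains the hull. This reduces permuting to closure of the sum.\<close>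

lemma subalgebra_bracket_subset_sum:
  assumes "subspace A" "subspace B" "lie_subalgebra (subalgebra_sum A B)"
  shows "subalgebra_bracket A B \<subseteq> subalgebra_sum A B"
  unfolding subalgebra_bracket_def
proof (rule hull_minimal)
  have "A \<subseteq> subalgebra_sum A B" "B \<subseteq> subalgebra_sum A B"
    using subspace_0[OF assms(1)] subspace_0[OF assms(2)] by (force simp: subalgebra_sum_def)+
  then show "{bracket a b |a b. a \<in> A \<and> b \<in> B} \<subseteq> subalgebra_sum A B"
    using assms(3) unfolding lie_subalgebra_def by blast
qed (rule assms(3))

end

text \<open>A Borel subalgebra has codimension one, so adding \<open>A\<close> gives either
  \<open>C\<close> again or the whole algebra.\<close>

lemma lie_subalgebra_sum_borel:
  assumes A: "sl2.lie_subalgebra A" and C: "C \<in> borels"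
  shows "sl2.lie_subalgebra (sl2.subalgebra_sum A C)"
proof (cases "A \<subseteq> C")
  case True
  then show ?thesis
    using A lie_subalgebra_borel[OF C] sl2.subalgebra_sum_absorb
    by (metis sl2.lie_subalgebra_def)
next
  case False
  then obtain a where a: "a \<in> A" "a \<notin> C"
    by auto
  have A': "sl2.subspace A" "A \<subseteq> sl2"
    using A by (auto simp: sl2.lie_subalgebra_def)
  obtain \<alpha> \<beta> \<gamma> where plane: "C = plane \<alpha> \<beta> \<gamma>"
    using C by (rule borels_cases)
  define f where "f v = \<alpha> * v $ 1 $ 1 + \<beta> * v $ 1 $ 2 + \<gamma> * v $ 2 $ 1" for v :: "'a^2^2"
  have C_iff: "v \<in> C \<longleftrightarrow> v \<in> sl2 \<and> f v = 0" for v
    by (simp add: plane plane_def f_def)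
  have "f a \<noteq> 0"
    using a A' by (auto simp: C_iff)
  have "v \<in> sl2.subalgebra_sum A C" if "v \<in> sl2" for v
  proof -
    \<comment> \<open>The multiple of \<open>a\<close> on which the functional \<open>f\<close>,
      whose kernel on \<open>sl2\<close> is \<open>C\<close>, agrees with its value at
      \<open>v\<close>.\<close>
    let ?u = "matrix_scale (f v / f a) a"
    have "f (v - matrix_scale c a) = f v - c * f a" for c
      by (simp add: f_def algebra_simps)
    then have "f (v - ?u) = 0"
      using \<open>f a \<noteq> 0\<close> by simp
    moreover have u: "?u \<in> A"
      using A'(1) a(1) by (rule sl2.subspace_scale)
    ultimately have "v - ?u \<in> C"
      using that A'(2) by (auto simp: C_iff intro!: sl2.subspace_diff[OF sl2.subspace_carrier])
    moreover have "v = ?u + (v - ?u)"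
      by simp
    ultimately show ?thesis
      unfolding sl2.subalgebra_sum_def using u by blast
  qed
  moreover have "sl2.subalgebra_sum A C \<subseteq> sl2"
    using A'(2) borel_subset_sl2[OF C]
    by (auto simp: sl2.subalgebra_sum_def intro!: sl2.subspace_add[OF sl2.subspace_carrier])
  ultimately have "sl2.subalgebra_sum A C = sl2"
    by auto
  then show ?thesis
    by (simp add: sl2.lie_subalgebra_def sl2.subspace_carrier sl2.bracket_closed)
qed

lemma permutes_if_not_lines:
  fixes A B :: "('a::field^2^2) set"
  assumes two: "(2 :: 'a) \<noteq> 0" and A: "A \<in> sl2.subalgebras" and B: "B \<in> sl2.subalgebras"
    and not_lines: "A \<notin> lines \<or> B \<notin> lines"
  shows "sl2.subalgebra_bracket A B \<subseteq> sl2.subalgebra_sum A B"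
proof -
  \<comment> \<open>Sums commute, so it suffices to treat the case where the first subalgebra is not
    a line.\<close>
  have *: "sl2.lie_subalgebra (sl2.subalgebra_sum A B)"
    if AB: "A \<in> sl2.subalgebras" "B \<in> sl2.subalgebras" "A \<notin> lines" for A B :: "('a^2^2) set"
  proof -
    have sub: "sl2.lie_subalgebra A" "sl2.lie_subalgebra B" "sl2.subspace A" "sl2.subspace B"
      "A \<subseteq> sl2" "B \<subseteq> sl2"
      using AB by (auto simp: sl2.subalgebras_def sl2.lie_subalgebra_def)
    consider "A = {0}" | "A = sl2" | "A \<in> borels"
      using AB subalgebras_sl2[OF two] by auto
    then show ?thesis
    proof cases
      case 1
      then have "sl2.subalgebra_sum A B = B"
        using sub by (auto simp: sl2.subalgebra_sum_def)
      with sub show ?thesis by simp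
    next
      case 2
      then have "sl2.subalgebra_sum B A = A"
        using sub by (intro sl2.subalgebra_sum_absorb) auto
      with sub show ?thesis by (simp add: sl2.subalgebra_sum_commute)
    next
      case 3
      then show ?thesis
        using lie_subalgebra_sum_borel[OF sub(2)] by (simp add: sl2.subalgebra_sum_commute)
    qed
  qed
  have "sl2.lie_subalgebra (sl2.subalgebra_sum A B)"
    using not_lines *[OF A B] *[OF B A] sl2.subalgebra_sum_commute[of A B] by auto
  then show ?thesis
    using A B
    by (intro sl2.subalgebra_bracket_subset_sum)
      (auto simp: sl2.subalgebras_def sl2.lie_subalgebra_def)
qed

section \<open>Pairs of distinct lines\<close>

lemma card_sum_lines:
  fixes A B :: "('a::{field,finite}^2^2) set"
  assumes "A \<in> lines" "B \<in> lines" "A \<noteq> B"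
  shows "card (sl2.subalgebra_sum A B) = (CARD('a))\<^sup>2"
proof -
  have sub: "sl2.subspace A" "sl2.subspace B"
    using assms lie_subalgebra_line by (auto simp: sl2.lie_subalgebra_def)
  have int: "x = 0" if "x \<in> A" "x \<in> B" for x
    using that assms line_eq_of_mem by metis
  have "inj_on (\<lambda>(x, y). x + y) (A \<times> B)"
  proof (rule inj_onI, clarify)
    fix x y x' y' assume xy: "x \<in> A" "y \<in> B" "x' \<in> A" "y' \<in> B" "x + y = x' + y'"
    then have "x - x' = y' - y"
      by (simp add: algebra_simps)
    then have "x - x' = 0"
      using xy int[of "x - x'"] sl2.subspace_diff[OF sub(1), of x x']
        sl2.subspace_diff[OF sub(2), of y' y] by simp
    with xy show "x = x' \<and> y = y'"
      by simp
  qed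
  moreover have "sl2.subalgebra_sum A B = (\<lambda>(x, y). x + y) ` (A \<times> B)"
    by (auto simp: sl2.subalgebra_sum_def)
  ultimately show ?thesis
    using assms by (simp add: card_image card_cartesian_product card_line power2_eq_square)
qed

text \<open>Both sides have \<open>q^2\<close> elements. Consequently two distinct lines lie in at
  most one Borel subalgebra.\<close>

lemma borel_eq_sum_lines:
  fixes A B :: "('a::{field,finite}^2^2) set"
  assumes "A \<in> lines" "B \<in> lines" "A \<noteq> B" "C \<in> borels" "A \<subseteq> C" "B \<subseteq> C"
  shows "sl2.subalgebra_sum A B = C"
proof (rule card_subset_eq)
  have "sl2.subspace C"
    using lie_subalgebra_borel[OF assms(4)] by (simp add: sl2.lie_subalgebra_def)
  then show "sl2.subalgebra_sum A B \<subseteq> C"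
    using assms by (auto simp: sl2.subalgebra_sum_def intro!: sl2.subspace_add)
qed (use assms in \<open>simp_all add: card_sum_lines card_borel\<close>)

text \<open>The bracket is alternating and bilinear, so only the determinant of the coefficients
  survives. Closure of the span of \<open>a\<close> and \<open>b\<close> thus depends on one
  bracket.\<close>

lemma commutator_lin_comb:
  fixes a b :: "'a::field^2^2"
  shows "commutator (matrix_scale r a + matrix_scale s b) (matrix_scale t a + matrix_scale u b) =
    matrix_scale (r * u - s * t) (commutator a b)"
  by (simp add: commutator_def vec_eq_iff forall_2 matrix_matrix_mult_def sum_2 algebra_simps)

text \<open>For lines this is the converse of \<open>subalgebra_bracket_subset_sum\<close>: the
  bracket of the two generators lies in the sum, and every other bracket is a multiple of
  it.\<close>

lemma lie_subalgebra_sum_lines: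
  assumes "A \<in> lines" "B \<in> lines" "sl2.subalgebra_bracket A B \<subseteq> sl2.subalgebra_sum A B"
  shows "sl2.lie_subalgebra (sl2.subalgebra_sum A B)"
proof -
  obtain a b where a: "a \<in> A" "A = line a" and b: "b \<in> B" "B = line b"
    using assms(1,2) lines_obtain by metis
  have sub: "sl2.subspace A" "sl2.subspace B" "A \<subseteq> sl2" "B \<subseteq> sl2"
    using assms(1,2) lie_subalgebra_line by (auto simp: sl2.lie_subalgebra_def)
  have sum: "sl2.subspace (sl2.subalgebra_sum A B)"
    unfolding sl2.subalgebra_sum_def using sub(1,2) by (rule sl2.subspace_sums)
  have "commutator a b \<in> sl2.subalgebra_bracket A B"
    unfolding sl2.subalgebra_bracket_def using a b by (blast intro: hull_inc)
  then have ab: "commutator a b \<in> sl2.subalgebra_sum A B"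
    using assms(3) by blast
  have "commutator x y \<in> sl2.subalgebra_sum A B"
    if xy: "x \<in> sl2.subalgebra_sum A B" "y \<in> sl2.subalgebra_sum A B" for x y
  proof -
    obtain r s t u where "x = matrix_scale r a + matrix_scale s b"
      "y = matrix_scale t a + matrix_scale u b"
      using xy by (auto simp: sl2.subalgebra_sum_def a(2) b(2) line_def)
    then show ?thesis
      using sl2.subspace_scale[OF sum ab] by (simp add: commutator_lin_comb)
  qed
  moreover have "sl2.subalgebra_sum A B \<subseteq> sl2"
    using sub
    by (auto simp: sl2.subalgebra_sum_def intro!: sl2.subspace_add[OF sl2.subspace_carrier])
  ultimately show ?thesis
    using sum by (simp add: sl2.lie_subalgebra_def)
qed

lemma distinct_lines_permute_iff:
  fixes A B :: "('a::{field,finite}^2^2) set"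
  assumes two: "(2 :: 'a) \<noteq> 0" and AB: "A \<in> lines" "B \<in> lines" "A \<noteq> B"
  shows "sl2.subalgebra_bracket A B \<subseteq> sl2.subalgebra_sum A B \<longleftrightarrow>
    (\<exists>C\<in>borels. A \<subseteq> C \<and> B \<subseteq> C)"
proof
  have sub: "sl2.subspace A" "sl2.subspace B"
    using AB lie_subalgebra_line by (auto simp: sl2.lie_subalgebra_def)
  show "sl2.subalgebra_bracket A B \<subseteq> sl2.subalgebra_sum A B"
    if "\<exists>C\<in>borels. A \<subseteq> C \<and> B \<subseteq> C"
    using that borel_eq_sum_lines[OF AB] lie_subalgebra_borel
      sl2.subalgebra_bracket_subset_sum[OF sub] by blast
  assume "sl2.subalgebra_bracket A B \<subseteq> sl2.subalgebra_sum A B"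
  then have "sl2.lie_subalgebra (sl2.subalgebra_sum A B)"
    using AB by (intro lie_subalgebra_sum_lines)
  then have "sl2.subalgebra_sum A B = {0} \<or> sl2.subalgebra_sum A B \<in> lines \<or>
      sl2.subalgebra_sum A B \<in> borels \<or> sl2.subalgebra_sum A B = sl2"
    by (rule subalgebra_cases[OF two])
  moreover have "card {0 :: 'a^2^2} = 1"
    by simp
  \<comment> \<open>The sum has \<open>q^2\<close> elements, which excludes the other three kinds of
    subalgebras.\<close>
  ultimately have "sl2.subalgebra_sum A B \<in> borels"
    using card_sum_lines[OF AB] card_line card_sl2 card_field_powers_distinct[where 'a = 'a]
    by metis
  moreover have "A \<subseteq> sl2.subalgebra_sum A B" "B \<subseteq> sl2.subalgebra_sum A B"
    using sl2.subspace_0[OF sub(1)] sl2.subspace_0[OF sub(2)]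
    by (force simp: sl2.subalgebra_sum_def)+
  ultimately show "\<exists>C\<in>borels. A \<subseteq> C \<and> B \<subseteq> C"
    by blast
qed

section \<open>Counting the permuting pairs\<close>

lemma card_lines_in_borel:
  assumes "C \<in> borels"
  shows "card {A \<in> lines. A \<subseteq> (C :: ('a::{field,finite}^2^2) set)} = CARD('a) + 1"
proof -
  have "sl2.subspace C"
    using lie_subalgebra_borel[OF assms] by (simp add: sl2.lie_subalgebra_def)
  then have "(CARD('a) - 1) * card {A \<in> lines. A \<subseteq> C} = (CARD('a))\<^sup>2 - 1"
    using card_lines_in_subspace[OF _ borel_subset_sl2[OF assms]] card_borel[OF assms] by simp
  also have "\<dots> = (CARD('a) - 1) * (CARD('a) + 1)"
    by (simp add: power2_eq_square algebra_simps)
  finally show ?thesis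
    using card_field_gt_1[where 'a = 'a] by (simp only: mult_cancel1) simp
qed

text \<open>The first three summands count the pairs of equal lines. The product counts, for each of
  the \<open>q + 1\<close> Borel subalgebras, the \<open>(q + 1) * q\<close> ordered pairs of
  distinct lines inside it.\<close>

lemma card_permuting_lines:
  assumes two: "(2 :: 'a::{field,finite}) \<noteq> 0"
  shows "card {(A, B) \<in> lines \<times> (lines :: ('a^2^2) set set).
      sl2.subalgebra_bracket A B \<subseteq> sl2.subalgebra_sum A B} =
    (CARD('a))\<^sup>2 + CARD('a) + 1 + (CARD('a) + 1) * ((CARD('a) + 1) * CARD('a))"
proof -
  define D where
    "D C = {A \<in> lines. A \<subseteq> C} \<times> {A \<in> lines. A \<subseteq> C} - Id_on {A \<in> lines. A \<subseteq> C}"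
    for C :: "('a^2^2) set"
  have self: "sl2.subalgebra_bracket A A \<subseteq> sl2.subalgebra_sum A A"
    if "A \<in> lines" for A :: "('a^2^2) set"
  proof -
    have A: "sl2.lie_subalgebra A" "sl2.subspace A"
      using lie_subalgebra_line[OF that] by (auto simp: sl2.lie_subalgebra_def)
    then show ?thesis
      by (intro sl2.subalgebra_bracket_subset_sum) (simp_all add: sl2.subalgebra_sum_absorb)
  qed
  have "{(A, B) \<in> lines \<times> (lines :: ('a^2^2) set set).
      sl2.subalgebra_bracket A B \<subseteq> sl2.subalgebra_sum A B} = Id_on lines \<union> (\<Union>C\<in>borels. D C)"
    (is "?G = ?R")
  proof (rule Set.set_eqI)
    fix X :: "('a^2^2) set \<times> ('a^2^2) set"
    obtain A B where X: "X = (A, B)"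
      by fastforce
    show "X \<in> ?G \<longleftrightarrow> X \<in> ?R"
    proof (cases "A = B")
      case True
      then show ?thesis
        using self by (auto simp: X D_def)
    next
      case False
      then show ?thesis
        using distinct_lines_permute_iff[OF two, of A B] by (auto simp: X D_def)
    qed
  qed
  moreover have "card (\<Union>C\<in>borels. D C) = (\<Sum>C\<in>borels. card (D C))"
  proof (rule card_UN_disjoint)
    show "\<forall>C\<in>borels. \<forall>C'\<in>borels. C \<noteq> C' \<longrightarrow> D C \<inter> D C' = {}"
    \<comment> \<open>A pair common to two of these sets would have its sum equal to both Borel
      subalgebras.\<close>
    proof (intro ballI impI equals0I)
      fix C C' X assume C: "C \<in> borels" "C' \<in> borels" "C \<noteq> C'" and X: "X \<in> D C \<inter> D C'"
      then obtain A B where "X = (A, B)" "A \<in> lines" "B \<in> lines" "A \<noteq> B"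
        "A \<subseteq> C" "B \<subseteq> C" "A \<subseteq> C'" "B \<subseteq> C'"
        by (auto simp: D_def)
      then show False
        using C borel_eq_sum_lines by metis
    qed
  qed auto
  moreover have "card (D C) = (CARD('a) + 1) * CARD('a)" if "C \<in> borels" for C
  proof -
    have "card (D C) = (CARD('a) + 1) * (CARD('a) + 1) - (CARD('a) + 1)"
      unfolding D_def
      by (subst card_Diff_subset)
        (auto simp: card_cartesian_product card_lines_in_borel[OF that] Id_on_def card_image
          inj_on_def UNION_singleton_eq_range)
    then show ?thesis
      by simp
  qed
  moreover have "card (Id_on (lines :: ('a^2^2) set set)) = (CARD('a))\<^sup>2 + CARD('a) + 1"
    by (simp add: Id_on_def UNION_singleton_eq_range card_image inj_on_def card_lines)
  moreover have "Id_on lines \<inter> (\<Union>C\<in>borels. D C) = {}"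
    by (auto simp: D_def)
  ultimately show ?thesis
    by (simp add: card_Un_disjoint card_borels[OF two])
qed

theorem theorem1p3:
  fixes p n q :: nat
  assumes "prime p" and "odd p" and "n > 0" and "q = p ^ n"
    and "CARD('a::{field,finite}) = q"
  shows "lie_algebra.sd (matrix_scale :: 'a \<Rightarrow> 'a^2^2 \<Rightarrow> 'a^2^2) commutator sl2
    = (3 * real q ^ 3 + 12 * real q ^ 2 + 16 * real q + 16)
      / (real q ^ 2 + 2 * real q + 4) ^ 2"
proof -
  have q: "CARD('a) = q"
    by fact
  have two: "(2 :: 'a) \<noteq> 0"
    using assms by (intro two_neq_zero_if_odd_card) simp
  let ?S = "sl2.subalgebras :: ('a^2^2) set set"
  let ?N = "lines :: ('a^2^2) set set"
  let ?perm = "\<lambda>A B :: ('a^2^2) set. sl2.subalgebra_bracket A B \<subseteq> sl2.subalgebra_sum A B"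
  let ?G = "{(A, B) \<in> ?N \<times> ?N. ?perm A B}"
  have NS: "?N \<subseteq> ?S"
    by (auto simp: subalgebras_sl2[OF two])
  have "?perm A B" if "A \<in> ?S" "B \<in> ?S" "A \<notin> ?N \<or> B \<notin> ?N" for A B
    using two that by (rule permutes_if_not_lines)
  \<comment> \<open>All pairs outside \<open>?N \<times> ?N\<close> permute, so only pairs of lines
    need to be counted individually.\<close>
  then have "{(A, B) \<in> ?S \<times> ?S. ?perm A B} = (?S \<times> ?S - ?N \<times> ?N) \<union> ?G"
    using NS by auto
  moreover have "card ((?S \<times> ?S - ?N \<times> ?N) \<union> ?G) = card (?S \<times> ?S - ?N \<times> ?N) + card ?G"
    by (rule card_Un_disjoint) auto
  moreover have "real (card (?S \<times> ?S - ?N \<times> ?N)) = (real (card ?S))\<^sup>2 - (real (card ?N))\<^sup>2"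
    using NS card_mono[OF _ NS]
    by (subst card_Diff_subset)
      (auto simp: card_cartesian_product power2_eq_square of_nat_diff mult_mono Sigma_mono)
  ultimately have "real (card {(A, B) \<in> ?S \<times> ?S. ?perm A B}) =
      (real (card ?S))\<^sup>2 - (real (card ?N))\<^sup>2 + real (card ?G)"
    by simp
  \<comment> \<open>The value is (q^2 + 2q + 4)^2 - (q^2 + q + 1)^2 + (q^2 + q + 1) + q (q + 1)^2,
    in which the fourth powers cancel.\<close>
  also have "\<dots> = 3 * real q ^ 3 + 12 * real q ^ 2 + 16 * real q + 16"
    unfolding card_permuting_lines[OF two] card_subalgebras_sl2[OF two] card_lines q
    by (simp add: power2_eq_square power3_eq_cube algebra_simps)
  finally show ?thesis
    by (simp add: sl2.sd_def card_subalgebras_sl2[OF two] q)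
qed

end
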